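(* Let $H$ be a separable infinite dimensional complex Hilbert space. For every bounded sequence of complex numbers $\langle d_n\rangle_{n=1}^\infty\in\ell^\infty$ there exist an idempotent $D\in B(H)$ (that is, $D^2=D$) and an orthonormal basis $\mathfrak b=\{b_n\}_{n=1}^\infty$ of $H$ such that $(Db_n,b_n)=d_n$ for all $n\in\mathbb{N}$.
   Context: Idempotents are bounded operators $D$ with $D^2=D$, not necessarily self-adjoint. $(\cdot,\cdot)$ is the inner product of $H$. *)

theory Defs
  imports "HOL-Analysis.Analysis"
begin

class complex_vector = real_vector +
  fixes scaleC :: "complex \<Rightarrow> 'a \<Rightarrow> 'a" (infixr "*\<^sub>C" 75)
  assumes scaleC_add_right: "a *\<^sub>C (x + y) = a *\<^sub>C x + a *\<^sub>C y"
    and scaleC_add_left: "(a + b) *\<^sub>C x = a *\<^sub>C x + b *\<^sub>C x"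
    and scaleC_scaleC: "a *\<^sub>C b *\<^sub>C x = (a * b) *\<^sub>C x"
    and scaleC_one: "1 *\<^sub>C x = x"
    and scaleC_of_real: "complex_of_real r *\<^sub>C x = r *\<^sub>R x"

global_interpretation complex_vector:
  vector_space "scaleC :: complex \<Rightarrow> 'a \<Rightarrow> 'a::complex_vector"
  defines cspan = complex_vector.span
  by unfold_locales
    (simp_all add: scaleC_add_right scaleC_add_left scaleC_scaleC scaleC_one)

(* The inner product is linear in the first argument and conjugate-linear in the second. *)
class complex_inner = complex_vector + real_normed_vector +
  fixes cinner :: "'a \<Rightarrow> 'a \<Rightarrow> complex"
  assumes cinner_commute: "cinner x y = cnj (cinner y x)"
    and cinner_add_left: "cinner (x + y) z = cinner x z + cinner y z"
    and cinner_scaleC_left: "cinner (a *\<^sub>C x) y = a * cinner x y"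
    and cinner_nonneg: "0 \<le> Re (cinner x x)"
    and cinner_eq_zero_iff: "cinner x x = 0 \<longleftrightarrow> x = 0"
    and norm_eq_sqrt_cinner: "norm x = sqrt (Re (cinner x x))"

class chilbert_space = complex_inner + complete_space

definition infinite_cdim :: "'a::complex_vector itself \<Rightarrow> bool" where
  "infinite_cdim _ \<longleftrightarrow> \<not> (\<exists>S :: 'a set. finite S \<and> cspan S = UNIV)"

definition bounded_clinear :: "('a::complex_inner \<Rightarrow> 'a) \<Rightarrow> bool" where
  "bounded_clinear T \<longleftrightarrow>
     Vector_Spaces.linear scaleC scaleC T \<and> (\<exists>K. \<forall>x. norm (T x) \<le> norm x * K)"

definition idempotent_operator :: "('a::complex_inner \<Rightarrow> 'a) \<Rightarrow> bool" where
  "idempotent_operator D \<longleftrightarrow> bounded_clinear D \<and> D \<circ> D = D"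

definition orthonormal_basis :: "(nat \<Rightarrow> 'a::complex_inner) \<Rightarrow> bool" where
  "orthonormal_basis b \<longleftrightarrow>
     (\<forall>m n. cinner (b m) (b n) = (if m = n then 1 else 0)) \<and>
     closure (cspan (range b)) = UNIV"

end

(* Index an orthonormal basis by the vertices of the binary tree and split H into the spans of the
   even and of the odd levels. For U mapping odd to even and Z mapping even to odd,
     D = (U, 1 - ZU)^T (Z, 1) = [[UZ, U], [Z - ZUZ, 1 - ZU]]
   is an idempotent because (Z, 1) (U, 1 - ZU)^T = 1. Let U be the adjacency operator of the tree and
   Z the adjacency operator weighted by a function e on the edges. Then the diagonal entries of UZ and
   of ZU at a vertex are the sum of e over the edges at that vertex. Prescribing these sums by a
   bounded function g is possible with bounded e: walking down from the root, let the two edges to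
   the children of n share equally what the edge to the parent leaves of g n. *)

theory Submission
  imports Defs
begin

section \<open>Algebra of the inner product and its norm\<close>

lemma cinner_zero_left [simp]: "cinner 0 (y::'a::complex_inner) = 0"
  using cinner_add_left[of 0 0 y] by simp

lemma cinner_diff_left: "cinner (x - y) (z::'a::complex_inner) = cinner x z - cinner y z"
  using cinner_add_left[of "x - y" y z] by simp

lemma cinner_scaleC_right: "cinner x (a *\<^sub>C y) = cnj a * cinner x (y::'a::complex_inner)"
  by (metis cinner_commute cinner_scaleC_left complex_cnj_mult)

lemma cinner_sum_left: "cinner (\<Sum>i\<in>S. f i) (y::'a::complex_inner) = (\<Sum>i\<in>S. cinner (f i) y)"
  by (induction S rule: infinite_finite_induct) (simp_all add: cinner_add_left)

lemma cinner_sum_right: "cinner y (\<Sum>i\<in>S. f i) = (\<Sum>i\<in>S. cinner (y::'a::complex_inner) (f i))"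
  by (subst cinner_commute) (simp add: cinner_sum_left cnj_sum, simp add: cinner_commute[symmetric])

lemma cinner_scaleR_left: "cinner (r *\<^sub>R x) (y::'a::complex_inner) = of_real r * cinner x y"
  by (metis cinner_scaleC_left scaleC_of_real)

lemma cinner_self: "cinner x (x::'a::complex_inner) = of_real ((norm x)\<^sup>2)"
proof -
  have "Im (cinner x x) = 0"
    using arg_cong[OF cinner_commute[of x x], of Im] by simp
  then show ?thesis
    by (simp add: complex_eq_iff norm_eq_sqrt_cinner cinner_nonneg)
qed

text \<open>The class axioms give homogeneity of the norm for real scalars only. For complex ones,
  compare the squares, where \<open>a * cnj a\<close> appears.\<close>

lemma norm_scaleC: "norm (a *\<^sub>C x) = cmod a * norm (x::'a::complex_inner)"
proof -
  have "complex_of_real ((norm (a *\<^sub>C x))\<^sup>2) = of_real ((cmod a * norm x)\<^sup>2)"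
    unfolding cinner_self[symmetric] cinner_scaleC_left cinner_scaleC_right
    by (simp add: cinner_self complex_norm_square power_mult_distrib mult.commute
        del: of_real_power)
  then show ?thesis
    by (simp only: of_real_eq_iff) (simp add: power2_eq_iff_nonneg)
qed

lemma bounded_linear_scaleC: "bounded_linear (\<lambda>x::'a::complex_inner. a *\<^sub>C x)"
proof (rule bounded_linear_intro)
  show "a *\<^sub>C (r *\<^sub>R x) = r *\<^sub>R (a *\<^sub>C x)" for r and x :: 'a
    by (simp add: scaleC_of_real[symmetric] scaleC_scaleC mult.commute)
  show "norm (a *\<^sub>C x) \<le> norm x * cmod a" for x :: 'a
    by (simp add: norm_scaleC)
qed (rule scaleC_add_right)

lemma pythagoras:
  fixes x y :: "'a::complex_inner"
  assumes "cinner x y = 0"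
  shows "(norm (x + y))\<^sup>2 = (norm x)\<^sup>2 + (norm y)\<^sup>2"
proof -
  have yx: "cinner y x = 0"
    using assms cinner_commute[of y x] by simp
  have add_right: "cinner z (x + y) = cinner z x + cinner z y" for z
    by (subst (1 2 3) cinner_commute) (simp add: cinner_add_left)
  have "complex_of_real ((norm (x + y))\<^sup>2) = of_real ((norm x)\<^sup>2 + (norm y)\<^sup>2)"
    unfolding of_real_add cinner_self[symmetric] cinner_add_left add_right
    using assms yx by simp
  then show ?thesis by (simp only: of_real_eq_iff)
qed

section \<open>Finite orthonormal sums, Bessel's inequality and projections\<close>

definition orthonormal_on :: "nat set \<Rightarrow> (nat \<Rightarrow> 'a::complex_inner) \<Rightarrow> bool" where
  "orthonormal_on S v \<longleftrightarrow> (\<forall>i\<in>S. \<forall>j\<in>S. cinner (v i) (v j) = (if i = j then 1 else 0))"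

lemma orthonormal_on_subset: "orthonormal_on S v \<Longrightarrow> T \<subseteq> S \<Longrightarrow> orthonormal_on T v"
  unfolding orthonormal_on_def by blast

lemma cinner_orthonormal_sum:
  assumes "orthonormal_on S v" "finite S" "j \<in> S"
  shows "cinner (\<Sum>i\<in>S. c i *\<^sub>C v i) (v j) = c j"
proof -
  have "cinner (\<Sum>i\<in>S. c i *\<^sub>C v i) (v j) = (\<Sum>i\<in>S. if i = j then c i else 0)"
    unfolding cinner_sum_left cinner_scaleC_left
    using assms by (intro sum.cong) (auto simp: orthonormal_on_def)
  also have "\<dots> = c j"
    using assms by simp
  finally show ?thesis .
qed

lemma norm_orthonormal_sum:
  assumes "orthonormal_on S v" "finite S"
  shows "norm (\<Sum>i\<in>S. c i *\<^sub>C v i) = L2_set (\<lambda>i. cmod (c i)) S"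
proof -
  let ?p = "\<Sum>i\<in>S. c i *\<^sub>C v i"
  have "cinner ?p ?p = (\<Sum>j\<in>S. cnj (c j) * cinner ?p (v j))"
    by (subst cinner_sum_right) (simp only: cinner_scaleC_right)
  also have "\<dots> = of_real (\<Sum>j\<in>S. (cmod (c j))\<^sup>2)"
    unfolding of_real_sum
  proof (rule sum.cong)
    show "cnj (c j) * cinner ?p (v j) = of_real ((cmod (c j))\<^sup>2)" if "j \<in> S" for j
      by (simp only: cinner_orthonormal_sum[OF assms that] complex_norm_square mult.commute)
  qed simp
  finally have "(norm ?p)\<^sup>2 = (\<Sum>j\<in>S. (cmod (c j))\<^sup>2)"
    unfolding cinner_self by (simp only: of_real_eq_iff)
  then show ?thesis
    by (simp add: L2_set_def real_sqrt_unique)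
qed

text \<open>The finite sum \<open>?p\<close> is the orthogonal projection of \<open>x\<close>: the
  remainder \<open>x - ?p\<close> is orthogonal to every \<open>v i\<close>, so Pythagoras gives
  that \<open>?p\<close> is no longer than \<open>x\<close>.\<close>

lemma bessel:
  assumes "orthonormal_on S v" "finite S"
  shows "L2_set (\<lambda>i. cmod (cinner x (v i))) S \<le> norm x"
proof -
  let ?p = "\<Sum>i\<in>S. cinner x (v i) *\<^sub>C v i"
  have "cinner (x - ?p) (v i) = 0" if "i \<in> S" for i
    by (simp add: cinner_diff_left cinner_orthonormal_sum[OF assms that])
  then have "cinner (x - ?p) ?p = 0"
    by (subst cinner_sum_right) (simp add: cinner_scaleC_right)
  from pythagoras[OF this] have "(norm ?p)\<^sup>2 \<le> (norm x)\<^sup>2"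
    by simp
  then show ?thesis
    unfolding norm_orthonormal_sum[OF assms] by (rule power2_le_imp_le) simp
qed

lemma cmod_cinner_unit_le:
  assumes "cinner u u = 1"
  shows "cmod (cinner x u) \<le> norm x"
  using bessel[of "{0}" "\<lambda>_. u" x] assms by (simp add: orthonormal_on_def L2_set_def)

text \<open>The projection \<open>P\<close> onto the finite-dimensional span is a contraction that
  fixes the span, so by density it fixes every vector. This is what rules out a finite Gram-Schmidt
  family in infinite dimension.\<close>

lemma cspan_orthonormal_eq_UNIV:
  fixes v :: "nat \<Rightarrow> 'a::complex_inner"
  assumes on: "orthonormal_on S v" and fin: "finite S" and dense: "closure (cspan (v ` S)) = UNIV"
  shows "cspan (v ` S) = UNIV"
proof -
  define P where "P x = (\<Sum>i\<in>S. cinner x (v i) *\<^sub>C v i)" for x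
  have P_le: "norm (P x) \<le> norm x" for x
    unfolding P_def norm_orthonormal_sum[OF on fin] by (rule bessel[OF on fin])
  have P_diff: "P (x - y) = P x - P y" for x y
    by (simp add: P_def cinner_diff_left complex_vector.scale_left_diff_distrib sum_subtractf)
  have P_span: "P x \<in> cspan (v ` S)" for x
    unfolding P_def
    by (intro complex_vector.span_sum complex_vector.span_scale complex_vector.span_base) auto
  have P_id: "P x = x" if "x \<in> cspan (v ` S)" for x
    using that
  proof (induction rule: complex_vector.span_induct_alt)
    case base
    then show ?case by (simp add: P_def)
  next
    case (step c x y)
    then obtain j where j: "j \<in> S" "x = v j" by blast
    have "P (c *\<^sub>C x + y) = c *\<^sub>C P x + P y"
      by (simp add: P_def cinner_add_left cinner_scaleC_left scaleC_add_left
          sum.distrib complex_vector.scale_sum_right)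
    moreover have "P (v j) = (\<Sum>i\<in>S. if i = j then v j else 0)"
      unfolding P_def using on j
      by (intro sum.cong) (auto simp: orthonormal_on_def scaleC_one)
    then have "P x = x"
      using j fin by simp
    ultimately show ?case using step by simp
  qed
  have "P x = x" for x
  proof -
    have "norm (P x - x) \<le> 0 + e" if "e > 0" for e
    proof -
      obtain y where y: "y \<in> cspan (v ` S)" "dist y x < e / 2"
        using dense closure_approachableD[of x "cspan (v ` S)" "e / 2"] \<open>e > 0\<close>
        unfolding dist_commute[of x] by auto
      \<comment> \<open>Since \<open>P\<close> fixes \<open>y\<close>, both summands have norm at
        most \<open>dist y x\<close>, which is below \<open>e / 2\<close>.\<close>
      have "P x - x = P (x - y) + (y - x)"
        by (simp add: P_diff P_id[OF y(1)])
      then have "norm (P x - x) \<le> norm (P (x - y)) + norm (y - x)"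
        by (simp only: norm_triangle_ineq)
      also have "\<dots> \<le> 0 + e"
        using P_le[of "x - y"] y(2) by (simp add: dist_norm norm_minus_commute)
      finally show ?thesis .
    qed
    then have "norm (P x - x) \<le> 0" by (rule field_le_epsilon)
    then show ?thesis by simp
  qed
  then show ?thesis using P_span by (metis UNIV_eq_I)
qed

subsection \<open>Gram--Schmidt\<close>

text \<open>Vectors depending on their predecessors yield \<open>0\<close>, since \<open>sgn 0 = 0\<close>.\<close>

fun gram_schmidt :: "(nat \<Rightarrow> 'a::complex_inner) \<Rightarrow> nat \<Rightarrow> 'a" where
  "gram_schmidt s k =
     sgn (s k - (\<Sum>i\<in>{..<k}. cinner (s k) (gram_schmidt s i) *\<^sub>C gram_schmidt s i))"

declare gram_schmidt.simps [simp del]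

lemma cinner_gram_schmidt_self:
  "gram_schmidt s k \<noteq> 0 \<Longrightarrow> cinner (gram_schmidt s k) (gram_schmidt s k) = 1"
  unfolding cinner_self by (subst (asm) gram_schmidt.simps, subst gram_schmidt.simps)
    (simp add: norm_sgn sgn_zero_iff)

text \<open>In the subtracted sum, paired with \<open>?v i\<close>, only the term
  \<open>j = i\<close> survives, by the induction hypothesis; it cancels the component of
  \<open>s k\<close> along \<open>?v i\<close>.\<close>

lemma cinner_gram_schmidt_less:
  "i < k \<Longrightarrow> cinner (gram_schmidt s k) (gram_schmidt s i) = 0"
proof (induction k arbitrary: i rule: less_induct)
  case (less k)
  let ?v = "gram_schmidt s"
  have orth: "cinner (?v j) (?v i) = 0" if "j < k" "j \<noteq> i" for j
  proof (cases "i < j")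
    case True
    then show ?thesis using less.IH that by blast
  next
    case False
    then have "cinner (?v i) (?v j) = 0" using less that by simp
    then show ?thesis by (metis cinner_commute complex_cnj_zero)
  qed
  have "cinner (\<Sum>j<k. cinner (s k) (?v j) *\<^sub>C ?v j) (?v i)
      = (\<Sum>j<k. if j = i then cinner (s k) (?v i) else 0)"
    unfolding cinner_sum_left cinner_scaleC_left
  proof (rule sum.cong)
    show "cinner (s k) (?v j) * cinner (?v j) (?v i) = (if j = i then cinner (s k) (?v i) else 0)"
      if "j \<in> {..<k}" for j
    proof (cases "j = i")
      case True
      \<comment> \<open>A discarded vector \<open>?v i = 0\<close> is not a unit vector, but then
        both sides vanish.\<close>
      have "cinner (s k) (?v i) = 0" if "?v i = 0"
        using that cinner_commute[of "s k" "?v i"] by simp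
      then show ?thesis
        using True cinner_gram_schmidt_self[of s i] by fastforce
    qed (use that orth in auto)
  qed simp
  also have "\<dots> = cinner (s k) (?v i)"
    using less.prems by simp
  finally show ?case
    by (subst gram_schmidt.simps)
      (simp add: sgn_div_norm cinner_scaleR_left cinner_diff_left)
qed

lemma orthonormal_on_gram_schmidt: "orthonormal_on {k. gram_schmidt s k \<noteq> 0} (gram_schmidt s)"
proof -
  have "cinner (gram_schmidt s i) (gram_schmidt s j) = 0" if "i \<noteq> j" for i j
    using that cinner_gram_schmidt_less
    by (metis cinner_commute complex_cnj_zero linorder_neqE_nat)
  then show ?thesis
    by (simp add: orthonormal_on_def cinner_gram_schmidt_self)
qed

text \<open>Undoing the normalization recovers \<open>s k\<close> from \<open>?v k\<close> and its
  predecessors; a dependent \<open>s k\<close> equals the projection \<open>p\<close>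
  itself.\<close>

lemma in_cspan_gram_schmidt: "s k \<in> cspan (gram_schmidt s ` {k. gram_schmidt s k \<noteq> 0})"
proof -
  let ?v = "gram_schmidt s" and ?V = "cspan (gram_schmidt s ` {k. gram_schmidt s k \<noteq> 0})"
  define p where "p = (\<Sum>i<k. cinner (s k) (?v i) *\<^sub>C ?v i)"
  have v_in: "?v i \<in> ?V" for i
    by (cases "?v i = 0") (auto intro: complex_vector.span_zero complex_vector.span_base)
  have "?v k = sgn (s k - p)"
    unfolding p_def by (rule gram_schmidt.simps)
  then have "s k = of_real (norm (s k - p)) *\<^sub>C ?v k + p"
    by (cases "s k = p") (simp_all add: scaleC_of_real sgn_div_norm)
  moreover have "p \<in> ?V"
    unfolding p_def by (intro complex_vector.span_sum complex_vector.span_scale v_in)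
  ultimately show ?thesis
    using v_in by (metis complex_vector.span_add complex_vector.span_scale)
qed

lemma orthonormal_basis_exists:
  assumes "separable_space (euclidean :: 'h::chilbert_space topology)"
    and "infinite_cdim TYPE('h)"
  shows "\<exists>b :: nat \<Rightarrow> 'h. orthonormal_basis b"
proof -
  obtain C :: "'h set" where C: "countable C" "closure C = UNIV"
    using assms(1) by (auto simp: separable_space_def)
  then have "C \<noteq> {}" by auto
  define v where "v = gram_schmidt (from_nat_into C)"
  define S where "S = {k. v k \<noteq> 0}"
  have on: "orthonormal_on S v"
    unfolding S_def v_def by (rule orthonormal_on_gram_schmidt)
  have "C \<subseteq> cspan (v ` S)"
  proof
    fix x assume "x \<in> C"
    then obtain k where "x = from_nat_into C k"
      using C(1) by (metis from_nat_into_surj)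
    then show "x \<in> cspan (v ` S)"
      unfolding S_def v_def using in_cspan_gram_schmidt by blast
  qed
  then have dense: "closure (cspan (v ` S)) = UNIV"
    using C(2) closure_mono by blast
  have "infinite S"
  proof
    assume "finite S"
    with cspan_orthonormal_eq_UNIV[OF on this dense] assms(2) show False
      unfolding infinite_cdim_def by blast
  qed
  \<comment> \<open>Discarding zero vectors leaves gaps in the index set. As \<open>S\<close> is
    infinite, \<open>enumerate S\<close> renumbers the remaining vectors by all natural
    numbers.\<close>
  then have S: "strict_mono (enumerate S)" "range (enumerate S) = S"
    by (auto simp: strict_mono_enumerate range_enumerate)
  have "cinner (v (enumerate S m)) (v (enumerate S n)) = (if m = n then 1 else 0)" for m n
    using on enumerate_in_set[OF \<open>infinite S\<close>] strict_mono_eq[OF S(1)]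
    by (simp add: orthonormal_on_def)
  moreover have "range (v \<circ> enumerate S) = v ` S"
    using S(2) by (metis image_comp)
  ultimately have "orthonormal_basis (v \<circ> enumerate S)"
    using dense unfolding orthonormal_basis_def by simp
  then show ?thesis by blast
qed


subsection \<open>Operators given by their action on coefficients\<close>

text \<open>Bounding all finite partial norms expresses membership in l2 with norm at most
  \<open>B\<close>, without any infinite sum.\<close>

definition l2_bound :: "(nat \<Rightarrow> complex) \<Rightarrow> real \<Rightarrow> bool" where
  "l2_bound c B \<longleftrightarrow> (\<forall>S. finite S \<longrightarrow> L2_set (\<lambda>n. cmod (c n)) S \<le> B)"

text \<open>\<open>F\<close> acts on arbitrary sequences and only its bound refers to l2. Identities
  such as idempotence can thus be checked entry by entry, free of convergence questions.\<close>

definition l2_operator :: "((nat \<Rightarrow> complex) \<Rightarrow> nat \<Rightarrow> complex) \<Rightarrow> bool" where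
  "l2_operator F \<longleftrightarrow>
     (\<forall>c c'. F (\<lambda>n. c n + c' n) = (\<lambda>n. F c n + F c' n)) \<and>
     (\<forall>a c. F (\<lambda>n. a * c n) = (\<lambda>n. a * F c n)) \<and>
     (\<exists>K. \<forall>c B. l2_bound c B \<longrightarrow> l2_bound (F c) (K * B))"

lemma l2_operator_compose:
  assumes "l2_operator F" "l2_operator G"
  shows "l2_operator (\<lambda>c. F (G c))"
proof -
  obtain K L where "\<And>c B. l2_bound c B \<Longrightarrow> l2_bound (F c) (K * B)"
    and "\<And>c B. l2_bound c B \<Longrightarrow> l2_bound (G c) (L * B)"
    using assms unfolding l2_operator_def by blast
  then have "\<forall>c B. l2_bound c B \<longrightarrow> l2_bound (F (G c)) ((K * L) * B)"
    by (simp add: mult.assoc)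
  then have "\<exists>M. \<forall>c B. l2_bound c B \<longrightarrow> l2_bound (F (G c)) (M * B)"
    by blast
  then show ?thesis
    using assms unfolding l2_operator_def by simp
qed

lemma l2_operator_add:
  assumes "l2_operator F" "l2_operator G"
  shows "l2_operator (\<lambda>c n. F c n + G c n)"
proof -
  obtain K L where K: "\<And>c B. l2_bound c B \<Longrightarrow> l2_bound (F c) (K * B)"
    and L: "\<And>c B. l2_bound c B \<Longrightarrow> l2_bound (G c) (L * B)"
    using assms unfolding l2_operator_def by blast
  have "l2_bound (\<lambda>n. F c n + G c n) ((K + L) * B)" if "l2_bound c B" for c B
    unfolding l2_bound_def
  proof (intro allI impI)
    fix S :: "nat set" assume S: "finite S"
    have "L2_set (\<lambda>n. cmod (F c n + G c n)) S \<le> L2_set (\<lambda>n. cmod (F c n) + cmod (G c n)) S"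
      by (intro L2_set_mono norm_triangle_ineq norm_ge_zero)
    also have "\<dots> \<le> L2_set (\<lambda>n. cmod (F c n)) S + L2_set (\<lambda>n. cmod (G c n)) S"
      by (rule L2_set_triangle_ineq)
    also have "\<dots> \<le> K * B + L * B"
      using K[OF that] L[OF that] S unfolding l2_bound_def by (intro add_mono) auto
    finally show "L2_set (\<lambda>n. cmod (F c n + G c n)) S \<le> (K + L) * B"
      by (simp add: distrib_right)
  qed
  then have "\<exists>M. \<forall>c B. l2_bound c B \<longrightarrow> l2_bound (\<lambda>n. F c n + G c n) (M * B)"
    by blast
  then show ?thesis
    using assms unfolding l2_operator_def by (simp add: algebra_simps)
qed

text \<open>Injectivity of \<open>\<phi>\<close> where the weight is nonzero means that each entry
  of \<open>c\<close> is used at most once, so reindexing turns the partial norm into one of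
  \<open>c\<close>, up to the factor \<open>M\<close>.\<close>

lemma l2_operator_weighted_comp:
  assumes inj: "inj_on \<phi> {n. w n \<noteq> 0}" and w: "\<And>n. cmod (w n) \<le> M"
  shows "l2_operator (\<lambda>c n. w n * c (\<phi> n))"
proof -
  have "M \<ge> 0"
    using w[of 0] norm_ge_zero order_trans by blast
  have "l2_bound (\<lambda>n. w n * c (\<phi> n)) (M * B)" if c: "l2_bound c B" for c B
    unfolding l2_bound_def
  proof (intro allI impI)
    fix S :: "nat set" assume S: "finite S"
    let ?T = "S \<inter> {n. w n \<noteq> 0}"
    have inj': "inj_on \<phi> ?T"
      using inj by (rule inj_on_subset) blast
    have "L2_set (\<lambda>n. cmod (w n * c (\<phi> n))) S = L2_set (\<lambda>n. cmod (w n * c (\<phi> n))) ?T"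
      unfolding L2_set_def using S
      by (intro arg_cong[of _ _ sqrt] sum.mono_neutral_right) auto
    also have "\<dots> \<le> L2_set (\<lambda>n. M * cmod (c (\<phi> n))) ?T"
      by (intro L2_set_mono) (auto simp: norm_mult intro: mult_right_mono w)
    also have "\<dots> = M * L2_set (\<lambda>n. cmod (c (\<phi> n))) ?T"
      using \<open>M \<ge> 0\<close> by (simp add: L2_set_right_distrib)
    also have "\<dots> = M * L2_set (\<lambda>n. cmod (c n)) (\<phi> ` ?T)"
      unfolding L2_set_def by (simp add: sum.reindex[OF inj'])
    also have "\<dots> \<le> M * B"
      using c S \<open>M \<ge> 0\<close> unfolding l2_bound_def by (intro mult_left_mono) auto
    finally show "L2_set (\<lambda>n. cmod (w n * c (\<phi> n))) S \<le> M * B" .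
  qed
  then have "\<exists>K. \<forall>c B. l2_bound c B \<longrightarrow> l2_bound (\<lambda>n. w n * c (\<phi> n)) (K * B)"
    by blast
  then show ?thesis
    unfolding l2_operator_def by (simp add: algebra_simps)
qed

lemma l2_operator_mult:
  assumes "\<And>n. cmod (w n) \<le> M"
  shows "l2_operator (\<lambda>c n. w n * c n)"
  using l2_operator_weighted_comp[of "\<lambda>n. n" w M] assms by simp

section \<open>Passing between square-summable coefficients and vectors\<close>

instance chilbert_space \<subseteq> banach ..

text \<open>A block of the series has norm equal to the root of the corresponding block of squared
  moduli. The Cauchy criterion therefore carries over from the convergent real series, with
  \<open>e\<close> replaced by its square.\<close>

lemma summable_synthesis:
  fixes b :: "nat \<Rightarrow> 'h::chilbert_space"
  assumes on: "orthonormal_on UNIV b" and c: "l2_bound c B"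
  shows "summable (\<lambda>n. c n *\<^sub>C b n)"
proof -
  have "(\<Sum>i<n. (cmod (c i))\<^sup>2) \<le> B\<^sup>2" for n
  proof -
    have "(L2_set (\<lambda>i. cmod (c i)) {..<n})\<^sup>2 \<le> B\<^sup>2"
      using c unfolding l2_bound_def by (intro power_mono) auto
    then show ?thesis
      by (simp add: L2_set_def sum_nonneg)
  qed
  then have "summable (\<lambda>i. (cmod (c i))\<^sup>2)"
    by (intro summableI_nonneg_bounded) auto
  then have Cauchy: "\<exists>N. \<forall>m\<ge>N. \<forall>n. norm (\<Sum>i=m..<n. (cmod (c i))\<^sup>2) < e" if "e > 0" for e
    using that by (simp add: summable_Cauchy)
  show ?thesis
    unfolding summable_Cauchy
  proof (intro allI impI)
    fix e :: real assume "e > 0"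
    then obtain N where N: "\<forall>m\<ge>N. \<forall>n. norm (\<Sum>i=m..<n. (cmod (c i))\<^sup>2) < e\<^sup>2"
      using Cauchy[of "e\<^sup>2"] by auto
    have "norm (\<Sum>i=m..<n. c i *\<^sub>C b i) < e" if "m \<ge> N" for m n
    proof -
      have "norm (\<Sum>i=m..<n. c i *\<^sub>C b i) = sqrt (\<Sum>i=m..<n. (cmod (c i))\<^sup>2)"
        using norm_orthonormal_sum[OF orthonormal_on_subset[OF on], of "{m..<n}" c]
        by (simp add: L2_set_def)
      also have "\<dots> < sqrt (e\<^sup>2)"
        using N that by (intro real_sqrt_less_mono) (auto simp: abs_less_iff)
      finally show ?thesis
        using \<open>e > 0\<close> by simp
    qed
    then show "\<exists>N. \<forall>m\<ge>N. \<forall>n. norm (\<Sum>i=m..<n. c i *\<^sub>C b i) < e" by blast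
  qed
qed

lemma norm_synthesis_le:
  fixes b :: "nat \<Rightarrow> 'h::chilbert_space"
  assumes on: "orthonormal_on UNIV b" and c: "l2_bound c B"
  shows "norm (\<Sum>n. c n *\<^sub>C b n) \<le> B"
proof -
  have "(\<lambda>N. norm (\<Sum>n<N. c n *\<^sub>C b n)) \<longlonglongrightarrow> norm (\<Sum>n. c n *\<^sub>C b n)"
    by (intro tendsto_norm summable_LIMSEQ summable_synthesis[OF assms])
  moreover have "norm (\<Sum>n<N. c n *\<^sub>C b n) \<le> B" for N
    using norm_orthonormal_sum[OF orthonormal_on_subset[OF on], of "{..<N}" c] c
    by (simp add: l2_bound_def)
  ultimately show ?thesis
    by (intro LIMSEQ_le_const2) auto
qed

text \<open>Pairing with the unit vector \<open>b m\<close> is a bounded linear functional, so it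
  may be moved inside the series, where orthonormality leaves one term.\<close>

lemma cinner_synthesis:
  fixes b :: "nat \<Rightarrow> 'h::chilbert_space"
  assumes on: "orthonormal_on UNIV b" and c: "l2_bound c B"
  shows "cinner (\<Sum>n. c n *\<^sub>C b n) (b m) = c m"
proof -
  have unit: "cinner (b m) (b m) = 1"
    using on by (simp add: orthonormal_on_def)
  have "bounded_linear (\<lambda>x. cinner x (b m))"
    by (rule bounded_linear_intro[of _ 1])
      (simp_all add: cinner_add_left cinner_scaleR_left scaleR_conv_of_real
        cmod_cinner_unit_le[OF unit])
  then have "cinner (\<Sum>n. c n *\<^sub>C b n) (b m) = (\<Sum>n. cinner (c n *\<^sub>C b n) (b m))"
    using summable_synthesis[OF assms] by (rule bounded_linear.suminf)
  also have "(\<lambda>n. cinner (c n *\<^sub>C b n) (b m)) = (\<lambda>n. if n = m then c n else 0)"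
    using on by (auto simp: orthonormal_on_def cinner_scaleC_left)
  also have "(\<Sum>n. if n = m then c n else 0) = c m"
    by (rule sums_unique[symmetric, OF sums_single])
  finally show ?thesis .
qed

text \<open>\<open>D\<close> takes coefficients, applies \<open>F\<close> and synthesizes. The
  coefficients of \<open>D x\<close> are again \<open>F (coeff x)\<close>, which carries idempotence
  and the diagonal from \<open>F\<close> over to \<open>D\<close>.\<close>

lemma idempotent_operator_of_coefficients:
  fixes b :: "nat \<Rightarrow> 'h::chilbert_space"
  assumes on: "orthonormal_on UNIV b" and F: "l2_operator F" and idem: "\<And>c. F (F c) = F c"
  shows "\<exists>D. idempotent_operator D \<and>
    (\<forall>n. cinner (D (b n)) (b n) = F (\<lambda>m. if m = n then 1 else 0) n)"
proof -
  obtain K where K: "\<And>c B. l2_bound c B \<Longrightarrow> l2_bound (F c) (K * B)"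
    using F unfolding l2_operator_def by blast
  define coeff where "coeff x = (\<lambda>n. cinner x (b n))" for x
  define D where "D x = (\<Sum>n. F (coeff x) n *\<^sub>C b n)" for x
  have bound: "l2_bound (F (coeff x)) (K * norm x)" for x
    unfolding coeff_def
    by (intro K) (simp add: l2_bound_def bessel orthonormal_on_subset[OF on])
  note summable = summable_synthesis[OF on bound]
  have coeff_D: "coeff (D x) = F (coeff x)" for x
    unfolding D_def by (subst coeff_def) (simp add: cinner_synthesis[OF on bound])
  have "D (x + y) = D x + D y" for x y
  proof -
    have "F (coeff (x + y)) = (\<lambda>n. F (coeff x) n + F (coeff y) n)"
      using F by (simp add: coeff_def cinner_add_left l2_operator_def)
    then show ?thesis
      unfolding D_def by (simp add: scaleC_add_left suminf_add[OF summable summable])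
  qed
  moreover have "D (a *\<^sub>C x) = a *\<^sub>C D x" for a x
  proof -
    have "F (coeff (a *\<^sub>C x)) = (\<lambda>n. a * F (coeff x) n)"
      using F by (simp add: coeff_def cinner_scaleC_left l2_operator_def)
    then have "D (a *\<^sub>C x) = (\<Sum>n. a *\<^sub>C F (coeff x) n *\<^sub>C b n)"
      unfolding D_def by (simp add: scaleC_scaleC)
    also have "\<dots> = a *\<^sub>C D x"
      unfolding D_def by (rule bounded_linear.suminf[OF bounded_linear_scaleC summable, symmetric])
    finally show ?thesis .
  qed
  moreover have "norm (D x) \<le> norm x * K" for x
    unfolding D_def using norm_synthesis_le[OF on bound, of x] by (simp add: mult.commute)
  ultimately have "bounded_clinear D"
    unfolding bounded_clinear_def
    by (auto simp: Vector_Spaces.linear_iff complex_vector.vector_space_axioms)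
  moreover have "D (D x) = D x" for x
    by (simp only: D_def[of "D x"] coeff_D idem) (simp only: D_def)
  ultimately have "idempotent_operator D"
    by (auto simp: idempotent_operator_def)
  moreover have "cinner (D (b n)) (b n) = F (\<lambda>m. if m = n then 1 else 0) n" for n
  proof -
    have "coeff (b n) = (\<lambda>m. if m = n then 1 else 0)"
      using on by (auto simp: coeff_def orthonormal_on_def)
    then show ?thesis
      using fun_cong[OF coeff_D[of "b n"], of n] by (simp add: coeff_def)
  qed
  ultimately show ?thesis by blast
qed

subsection \<open>Weights on the binary tree\<close>

text \<open>The natural numbers form a binary tree in which \<open>n\<close> has the children \<open>2 * n + 1\<close> and
  \<open>2 * n + 2\<close>; an edge is labelled by its lower end.\<close>

definition tree_op :: "(nat \<Rightarrow> complex) \<Rightarrow> (nat \<Rightarrow> complex) \<Rightarrow> nat \<Rightarrow> complex" where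
  "tree_op e c n = e (2 * n + 1) * c (2 * n + 1) + e (2 * n + 2) * c (2 * n + 2) +
     (if n = 0 then 0 else e n * c ((n - 1) div 2))"

text \<open>The parent of \<open>Suc n\<close> is \<open>n div 2\<close>, so the recursion flips the
  parity of the depth at each edge.\<close>

fun odd_level :: "nat \<Rightarrow> bool" where
  "odd_level 0 = False"
| "odd_level (Suc n) = (\<not> odd_level (n div 2))"

text \<open>The value at \<open>0\<close> stands for a fictitious edge above the root, so the root
  obeys the same rule as every other vertex.\<close>

fun edge_weight :: "(nat \<Rightarrow> complex) \<Rightarrow> nat \<Rightarrow> complex" where
  "edge_weight g 0 = 0"
| "edge_weight g (Suc n) = (g (n div 2) - edge_weight g (n div 2)) / 2"

lemma edge_weight_sum:
  "edge_weight g (2 * n + 1) + edge_weight g (2 * n + 2) + edge_weight g n = g n"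
proof -
  have "edge_weight g (2 * n + 1) = (g n - edge_weight g n) / 2"
    "edge_weight g (2 * n + 2) = (g n - edge_weight g n) / 2"
    by simp_all
  moreover have "x / 2 + x / 2 = x" for x :: complex
    by (simp add: field_simps)
  ultimately show ?thesis by (simp only: diff_add_cancel)
qed

text \<open>The bound does not grow with depth: the triangle inequality costs a factor of 2, and
  sharing between two children regains it.\<close>

lemma cmod_edge_weight_le:
  assumes "\<And>n. cmod (g n) \<le> M"
  shows "cmod (edge_weight g n) \<le> M"
proof (induction n rule: less_induct)
  case (less n)
  show ?case
  proof (cases n)
    case 0
    have "0 \<le> M" using assms[of 0] norm_ge_zero order_trans by blast
    with 0 show ?thesis by simp
  next
    case (Suc m)
    then have "cmod (edge_weight g (m div 2)) \<le> M"
      by (intro less.IH) simp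
    then have "cmod (g (m div 2) - edge_weight g (m div 2)) \<le> M + M"
      using norm_triangle_ineq4 assms[of "m div 2"] by (meson add_mono order_trans)
    then show ?thesis
      using Suc by (simp add: norm_divide)
  qed
qed

text \<open>The tree is bipartite: all neighbours of \<open>n\<close> lie on levels of the other
  parity.\<close>

lemma tree_op_cong:
  assumes "\<And>m. odd_level m \<noteq> odd_level n \<Longrightarrow> c m = c' m"
  shows "tree_op e c n = tree_op e c' n"
proof -
  have "c (2 * n + 1) = c' (2 * n + 1)" "c (2 * n + 2) = c' (2 * n + 2)"
    by (rule assms; simp)+
  moreover have "c ((n - 1) div 2) = c' ((n - 1) div 2)" if "n \<noteq> 0"
    using that by (cases n) (auto intro: assms)
  ultimately show ?thesis
    by (simp add: tree_op_def)
qed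

text \<open>Diagonal entries count closed walks of length 2, which traverse one edge at
  \<open>n\<close> and return along it, picking up \<open>e\<close> and \<open>f\<close> on that
  edge.\<close>

lemma tree_op_tree_op_diagonal:
  "tree_op e (tree_op f (\<lambda>m. if m = n then 1 else 0)) n =
     e (2 * n + 1) * f (2 * n + 1) + e (2 * n + 2) * f (2 * n + 2) + (if n = 0 then 0 else e n * f n)"
proof -
  let ?\<delta> = "\<lambda>m. if m = n then 1 else (0::complex)"
  have "tree_op f ?\<delta> (2 * n + 1) = f (2 * n + 1)" "tree_op f ?\<delta> (2 * n + 2) = f (2 * n + 2)"
    by (auto simp: tree_op_def)
  moreover have "tree_op f ?\<delta> ((n - 1) div 2) = f n" if "n \<noteq> 0"
  proof -
    define p where "p = (n - 1) div 2"
    have "n = 2 * p + 1 \<or> n = 2 * p + 2"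
      using that unfolding p_def by presburger
    \<comment> \<open>The grandparent of \<open>n\<close> is not \<open>n\<close>, so the parent
      term at \<open>p\<close> contributes nothing.\<close>
    moreover have "n \<noteq> (p - 1) div 2"
      using calculation div_le_dividend[of "p - 1" 2] by linarith
    ultimately show ?thesis
      unfolding p_def[symmetric] by (auto simp: tree_op_def)
  qed
  ultimately show ?thesis
    by (simp add: tree_op_def[of e])
qed

text \<open>The parent map is two-to-one. Splitting its term into odd and even \<open>n\<close>, the
  left and right children, gives four weighted compositions, each injective where its weight is
  nonzero.\<close>

lemma l2_operator_tree_op:
  assumes e: "\<And>n. cmod (e n) \<le> M"
  shows "l2_operator (tree_op e)"
proof -
  have "M \<ge> 0"
    using e[of 0] norm_ge_zero order_trans by blast
  have "l2_operator (\<lambda>c n. e (2 * n + 1) * c (2 * n + 1))"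
    using l2_operator_weighted_comp[of "\<lambda>n. 2 * n + 1" "\<lambda>n. e (2 * n + 1)" M] e
    by (simp add: inj_on_def)
  moreover have "l2_operator (\<lambda>c n. e (2 * n + 2) * c (2 * n + 2))"
    using l2_operator_weighted_comp[of "\<lambda>n. 2 * n + 2" "\<lambda>n. e (2 * n + 2)" M] e
    by (simp add: inj_on_def)
  moreover have "l2_operator (\<lambda>c n. (if odd n then e n else 0) * c ((n - 1) div 2))"
    using e \<open>M \<ge> 0\<close>
    by (intro l2_operator_weighted_comp[of _ _ M]) (auto simp: inj_on_def elim!: oddE)
  moreover have "l2_operator (\<lambda>c n. (if even n \<and> n \<noteq> 0 then e n else 0) * c ((n - 1) div 2))"
  proof (intro l2_operator_weighted_comp[of _ _ M])
    show "inj_on (\<lambda>n. (n - 1) div 2) {n. (if even n \<and> n \<noteq> 0 then e n else 0) \<noteq> 0}"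
    proof (rule inj_onI)
      fix x y :: nat
      assume "x \<in> {n. (if even n \<and> n \<noteq> 0 then e n else 0) \<noteq> 0}"
        "y \<in> {n. (if even n \<and> n \<noteq> 0 then e n else 0) \<noteq> 0}"
        and eq: "(x - 1) div 2 = (y - 1) div 2"
      then have "even x" "x \<noteq> 0" "even y" "y \<noteq> 0"
        by (auto split: if_splits)
      moreover from this have "x = 2 * ((x - 1) div 2) + 2" "y = 2 * ((y - 1) div 2) + 2"
        by presburger+
      ultimately show "x = y" using eq by simp
    qed
  qed (use e \<open>M \<ge> 0\<close> in auto)
  ultimately have "l2_operator (\<lambda>c n. e (2 * n + 1) * c (2 * n + 1) + e (2 * n + 2) * c (2 * n + 2) +
      ((if odd n then e n else 0) * c ((n - 1) div 2) +
       (if even n \<and> n \<noteq> 0 then e n else 0) * c ((n - 1) div 2)))"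
    by (intro l2_operator_add)
  moreover have "tree_op e = (\<lambda>c n. e (2 * n + 1) * c (2 * n + 1) + e (2 * n + 2) * c (2 * n + 2) +
      ((if odd n then e n else 0) * c ((n - 1) div 2) +
       (if even n \<and> n \<noteq> 0 then e n else 0) * c ((n - 1) div 2)))"
    by (intro ext) (auto simp: tree_op_def)
  ultimately show ?thesis by simp
qed

section \<open>The idempotent on coefficient sequences\<close>

lemma idempotent_with_prescribed_diagonal:
  assumes "bounded (range d)"
  shows "\<exists>F. l2_operator F \<and> (\<forall>c. F (F c) = F c) \<and>
    (\<forall>n. F (\<lambda>m. if m = n then 1 else 0) n = d n)"
proof -
  \<comment> \<open>On even levels the diagonal of \<open>F\<close> is that of UZ, hence
    \<open>g\<close> itself; on odd levels it is that of 1 - ZU, hence \<open>1 - g\<close>.\<close>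
  define g where "g n = (if odd_level n then 1 - d n else d n)" for n
  define e where "e = edge_weight g"
  obtain M0 where M0: "\<And>n. cmod (d n) \<le> M0"
    using assms by (auto simp: bounded_iff)
  have "cmod (g n) \<le> 1 + M0" for n
    using M0[of n] norm_triangle_ineq4[of 1 "d n"] by (auto simp: g_def)
  then have e_le: "cmod (e n) \<le> 1 + M0" for n
    unfolding e_def by (rule cmod_edge_weight_le)
  have e_sum: "e (2 * n + 1) + e (2 * n + 2) + (if n = 0 then 0 else e n) = g n" for n
    using edge_weight_sum[of g n] by (auto simp: e_def)

  \<comment> \<open>\<open>Q\<close> and \<open>E\<close> project onto the odd and even levels.
    \<open>L\<close> is the row (Z, 1), with values on odd levels, and \<open>R\<close> is the
    column (U, 1 - ZU).\<close>
  define Q where "Q c = (\<lambda>n. (if odd_level n then 1 else 0) * c n)" for c :: "nat \<Rightarrow> complex"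
  define E where "E c = (\<lambda>n. (if odd_level n then 0 else 1) * c n)" for c :: "nat \<Rightarrow> complex"
  define U where "U c = E (tree_op (\<lambda>_. 1) c)" for c
  define Z where "Z c = Q (tree_op e c)" for c
  define L where "L c = (\<lambda>n. Z c n + Q c n)" for c
  define R where "R c = (\<lambda>n. U c n + (Q c n + (-1) * Z (U c) n))" for c
  define F where "F c = R (L c)" for c
  have op: "l2_operator Q" "l2_operator E" "l2_operator (\<lambda>c n. (-1) * c n)"
    unfolding Q_def E_def by (rule l2_operator_mult[of _ 1]; simp)+
  have opU: "l2_operator U" and opZ: "l2_operator Z"
    unfolding U_def Z_def
    by (intro l2_operator_compose[OF op(2)] l2_operator_compose[OF op(1)]
        l2_operator_tree_op[of _ 1] l2_operator_tree_op[OF e_le]; simp)+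
  have "l2_operator (\<lambda>c n. (-1) * Z (U c) n)"
    using l2_operator_compose[OF op(3) l2_operator_compose[OF opZ opU]] .
  then have "l2_operator R"
    unfolding R_def by (intro l2_operator_add opU op(1))
  moreover have "l2_operator L"
    unfolding L_def by (intro l2_operator_add opZ op(1))
  ultimately have "l2_operator F"
    unfolding F_def by (rule l2_operator_compose)

  have UQ: "U (Q c) = U c" for c
  proof
    show "U (Q c) n = U c n" for n
      using tree_op_cong[of n "Q c" c "\<lambda>_. 1"] by (auto simp: U_def E_def Q_def)
  qed
  have QQ: "Q (Q c) = Q c" for c
    by (auto simp: Q_def)
  have RQ: "R (Q c) = R c" for c
    by (simp add: R_def UQ QQ)
  \<comment> \<open>On odd levels \<open>Z\<close> sees only the even part \<open>U c\<close> of
    \<open>R c\<close>, and the resulting \<open>Z (U c)\<close> cancels against the correction in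
    \<open>R\<close>. The identity of the odd part is \<open>Q\<close> here, since sequences live on
    the whole tree.\<close>
  have LR: "L (R c) = Q c" for c
  proof
    fix n
    have "tree_op e (R c) n = tree_op e (U c) n" if "odd_level n"
      using that by (intro tree_op_cong) (auto simp: R_def Q_def Z_def)
    then show "L (R c) n = Q c n"
      by (simp add: L_def Z_def Q_def) (simp add: R_def U_def E_def Q_def Z_def)
  qed
  have "F (F c) = F c" for c
    by (simp add: F_def LR RQ)
  moreover have "F (\<lambda>m. if m = n then 1 else 0) n = d n" for n
  proof -
    let ?\<delta> = "\<lambda>m. if m = n then 1 else (0::complex)"
    show ?thesis
    proof (cases "odd_level n")
      case False
      have "F ?\<delta> n = tree_op (\<lambda>_. 1) (L ?\<delta>) n"
        using False by (simp add: F_def R_def U_def E_def Q_def Z_def)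
      \<comment> \<open>The odd neighbours of the even vertex \<open>n\<close> see
        \<open>L ?\<delta>\<close> as \<open>Z ?\<delta>\<close>, because \<open>Q ?\<delta>\<close>
        vanishes.\<close>
      also have "\<dots> = tree_op (\<lambda>_. 1) (tree_op e ?\<delta>) n"
        using False by (intro tree_op_cong) (auto simp: L_def Z_def Q_def)
      also have "\<dots> = g n"
        using e_sum[of n] unfolding tree_op_tree_op_diagonal by (simp split: if_splits)
      finally show ?thesis
        using False by (simp add: g_def)
    next
      case True
      \<comment> \<open>Here \<open>?\<delta>\<close> is supported on an odd level, while an odd
        vertex has only even neighbours; so \<open>Z ?\<delta> = 0\<close>.\<close>
      have "tree_op e ?\<delta> m = 0" if "odd_level m" for m
      proof -
        have "tree_op e ?\<delta> m = tree_op e (\<lambda>_. 0) m"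
          using True that by (intro tree_op_cong) auto
        then show ?thesis by (simp add: tree_op_def)
      qed
      then have "L ?\<delta> = ?\<delta>"
        using True by (auto simp: L_def Z_def Q_def)
      then have "F ?\<delta> n = 1 - tree_op e (U ?\<delta>) n"
        using True by (simp add: F_def R_def U_def E_def Q_def Z_def)
      also have "tree_op e (U ?\<delta>) n = tree_op e (tree_op (\<lambda>_. 1) ?\<delta>) n"
        using True by (intro tree_op_cong) (auto simp: U_def E_def)
      also have "\<dots> = g n"
        using e_sum[of n] unfolding tree_op_tree_op_diagonal by (simp split: if_splits)
      finally show ?thesis
        using True by (simp add: g_def)
    qed
  qed
  ultimately show ?thesis
    using \<open>l2_operator F\<close> by blast
qed

theorem theorem3p7:
  fixes d :: "nat \<Rightarrow> complex"
  assumes "separable_space (euclidean :: 'h::chilbert_space topology)"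
    and "infinite_cdim TYPE('h)"
    and "bounded (range d)"
  shows "\<exists>(D :: 'h \<Rightarrow> 'h) (b :: nat \<Rightarrow> 'h).
           idempotent_operator D \<and> orthonormal_basis b \<and>
           (\<forall>n. cinner (D (b n)) (b n) = d n)"
proof -
  \<comment> \<open>The basis is fixed independently of \<open>d\<close>; only the idempotent is
    adapted to the prescribed diagonal.\<close>
  obtain b :: "nat \<Rightarrow> 'h" where b: "orthonormal_basis b"
    using orthonormal_basis_exists[OF assms(1,2)] by blast
  then have on: "orthonormal_on UNIV b"
    by (simp add: orthonormal_basis_def orthonormal_on_def)
  obtain F where F: "l2_operator F" "\<And>c. F (F c) = F c"
    and diag: "\<And>n. F (\<lambda>m. if m = n then 1 else 0) n = d n"
    using idempotent_with_prescribed_diagonal[OF assms(3)] by blast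
  from idempotent_operator_of_coefficients[OF on F] diag b show ?thesis
    by auto
qed

end
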